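(* Let $\mathcal{A}$, $\mathcal{B}$ and $\{g_j(x)\}_{j=1}^\ell$ be the $d$-dimensional $\mathbb{F}_q$-subspace of $\mathbb{F}_{q^\ell}$, the basis of $\mathbb{F}_{q^\ell}$ over $\mathbb{F}_q$, and the repair polynomials produced by the construction described in the context, with parameters $q,\ell,d,s,r,m$ satisfying the conditions listed there, and let $n=q^d$. Then the linear repair scheme $\{g_j(x)\}_{j=1}^\ell$ for node $0$ of ${\rm RS}(\mathcal{A},q^d-r)$ has I/O cost with respect to $\mathcal{B}$ equal to $$\gamma_{I/O}=(n-1)\ell-mq^{d-1}.$$ Moreover, the repair bandwidth of the scheme is equal to its I/O cost.
   Context: General definitions. Let $B=\mathbb{F}_q$, $F=\mathbb{F}_{q^\ell}$ with $\ell>1$, ${\rm Tr}_{F/B}$ the trace, $K={\rm Ker}({\rm Tr}_{F/B})$. For $\mathcal{A}=\{\alpha_1,\dots,\alpha_n\}\subseteq F$ and $1\le k<n$, ${\rm RS}(\mathcal{A},k)=\{(f(\alpha_1),\dots,f(\alpha_n)): f\in F[x],\ \deg f\le k-1\}$; coordinate $i$ is called node $i$, and "node $0$" means the coordinate with evaluation point $0$. When $\mathcal{A}$ is a $B$-linear subspace of $F$, ${\rm RS}(\mathcal{A},k)^\perp={\rm RS}(\mathcal{A},n-k)$. A linear repair scheme (over $B$) for node $i^*$ of ${\rm RS}(\mathcal{A},k)$ is a list of $\ell$ polynomials $g_1,\dots,g_\ell\in F[x]$ of degree less than $n-k$ such that $g_1(\alpha_{i^*}),\dots,g_\ell(\alpha_{i^*})$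 are linearly independent over $B$. Given a basis $\mathcal{B}=\{\beta^{(1)},\dots,\beta^{(\ell)}\}$ of $F$ over $B$, let $W_i$ be the $\ell\times\ell$ matrix over $B$ whose $(j,\nu)$ entry is ${\rm Tr}_{F/B}(g_j(\alpha_i)\beta^{(\nu)})$. The I/O cost with respect to $\mathcal{B}$ is $\gamma_{I/O}=\sum_{i=1}^n{\rm nz}(W_i)-\ell=\sum_{i\ne i^*}{\rm nz}(W_i)$, where ${\rm nz}(W)$ is the number of nonzero columns of $W$; the repair bandwidth is $\sum_{i=1}^n{\rm rank}(W_i)-\ell=\sum_{i\ne i^*}{\rm rank}(W_i)$. Construction. Let $d<\ell$, $k=q^d-r$ with $r\ge q^s+1$ for an integer $s\ge0$, and let $m$ be a positive integer with $m\le\ell-d+s+1$ and $m\mid\ell$. (1) Let $\{\gamma^{(1)}=1,\gamma^{(2)},\dots,\gamma^{(m)}\}$ be a basis of $\mathbb{F}_{q^m}$ over $B$ and $\{\lambda_1=1,\lambda_2,\dots,\lambda_{\ell/m}\}$ a basis of $F$ over $\mathbb{F}_{q^m}$. Set $\gamma^{((i-1)m+j)}=\lambda_i\gamma^{(j)}$ for $1\le i\le\ell/m$, $1\le j\le m$; then $\hat{\mathcal{B}}=\{\gamma^{(1)},\dots,\gamma^{(\ell)}\}$ is a basis of $F$ over $B$. Let $\mathcal{B}=\{\beta^{(1)},\dots,\beta^{(\ell)}\}$ be its dual basis, i.e. ${\rm Tr}_{F/B}(\beta^{(i)}\gamma^{(j)})=1$ if $i=j$ and $0$ otherwise. (2)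 If $s=0$, let $L(x)=\alpha x$ with an arbitrary $\alpha\in F\setminus\{0\}$. If $s>0$, let $L(x)=\sum_{j=0}^s\theta_jx^{q^j}\in F[x]$ be a $q$-polynomial of degree $q^s$ (so $\theta_s\neq0$) with $L(F)=\bigcap_{i=2}^{s+1}(\beta^{(i)})^{-1}K$ (such $L$ exists). Let $W=\bigcap_{i=2}^{\ell-d+s+1}(\beta^{(i)})^{-1}K$ and $\mathcal{A}=L^{-1}(W)=\{x\in F: L(x)\in W\}$; it is a $B$-subspace of $F$ of dimension $d$. (3) Define $g_j(x)=\gamma^{(j)}L(x)+\gamma^{(j)}$ for $1\le j\le m$ and $g_j(x)=\gamma^{(j)}$ for $m+1\le j\le\ell$. *)

theory Defs
  imports
    "HOL-Library.Cardinality"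
    "HOL-Computational_Algebra.Computational_Algebra"
    "Jordan_Normal_Form.DL_Rank"
begin

text \<open>
  Field extensions \<open>F / B\<close> are given by two fields (as types) together with an embedding
  \<open>\<iota> : B \<rightarrow> F\<close>, i.e. \<open>field_hom \<iota>\<close>; \<open>F\<close> is then a \<open>B\<close>-vector space with scalar
  multiplication \<open>ext_scale \<iota>\<close>.
\<close>

definition ext_scale :: "('b::field \<Rightarrow> 'f::field) \<Rightarrow> 'b \<Rightarrow> 'f \<Rightarrow> 'f" where
  "ext_scale \<iota> c x = \<iota> c * x"

definition ext_degree :: "('b::field \<Rightarrow> 'f::field) \<Rightarrow> nat" where
  "ext_degree \<iota> = Vector_Spaces.vector_space.dim (ext_scale \<iota>) (UNIV :: 'f set)"

definition indep_family ::
    "('b::field \<Rightarrow> 'f::field) \<Rightarrow> nat set \<Rightarrow> (nat \<Rightarrow> 'f) \<Rightarrow> bool" where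
  "indep_family \<iota> I v \<longleftrightarrow> inj_on v I \<and> \<not> Modules.module.dependent (ext_scale \<iota>) (v ` I)"

definition basis_family ::
    "('b::field \<Rightarrow> 'f::field) \<Rightarrow> nat set \<Rightarrow> (nat \<Rightarrow> 'f) \<Rightarrow> bool" where
  "basis_family \<iota> I v \<longleftrightarrow>
     indep_family \<iota> I v \<and> Modules.module.span (ext_scale \<iota>) (v ` I) = UNIV"

text \<open>
  The sum of the conjugates lies in the image of \<open>B\<close> (see \<open>embed_trace\<close> below), so that
  pulling it back along the embedding is meaningful.
\<close>

definition trace :: "('b::finite_field \<Rightarrow> 'f::finite_field) \<Rightarrow> 'f \<Rightarrow> 'b" where
  "trace \<iota> x = the_inv \<iota> (\<Sum>i<ext_degree \<iota>. x ^ (CARD('b) ^ i))"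

definition trace_kernel :: "('b::finite_field \<Rightarrow> 'f::finite_field) \<Rightarrow> 'f set" where
  "trace_kernel \<iota> = {x. trace \<iota> x = 0}"

text \<open>
  The nodes of the Reed--Solomon code of dimension \<open>k\<close> on \<open>A\<close> are identified with the
  evaluation points. A repair scheme for node \<open>a\<close> consists of the polynomials \<open>g j\<close> for
  \<open>1 \<le> j \<le> ext_degree \<iota>\<close>; values of \<open>g\<close> at other indices are irrelevant.
\<close>

definition linear_repair_scheme ::
    "('b::finite_field \<Rightarrow> 'f::finite_field) \<Rightarrow> 'f set \<Rightarrow> nat \<Rightarrow> 'f \<Rightarrow> (nat \<Rightarrow> 'f poly) \<Rightarrow> bool"
where
  "linear_repair_scheme \<iota> A k a g \<longleftrightarrow>
     1 \<le> k \<and> k < card A \<and> a \<in> A \<and>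
     (\<forall>j\<in>{1..ext_degree \<iota>}. degree (g j) < card A - k) \<and>
     indep_family \<iota> {1..ext_degree \<iota>} (\<lambda>j. poly (g j) a)"

text \<open>Matrix indices start at 0, the indices of \<open>g\<close> and \<open>\<beta>\<close> at 1.\<close>

definition repair_matrix ::
    "('b::finite_field \<Rightarrow> 'f::finite_field) \<Rightarrow> (nat \<Rightarrow> 'f) \<Rightarrow> (nat \<Rightarrow> 'f poly) \<Rightarrow> 'f \<Rightarrow> 'b mat"
where
  "repair_matrix \<iota> \<beta> g a =
     mat (ext_degree \<iota>) (ext_degree \<iota>)
       (\<lambda>(j, \<nu>). trace \<iota> (poly (g (Suc j)) a * \<beta> (Suc \<nu>)))"

definition nz :: "'b::zero mat \<Rightarrow> nat" where
  "nz M = card {\<nu>. \<nu> < dim_col M \<and> col M \<nu> \<noteq> 0\<^sub>v (dim_row M)}"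

definition io_cost ::
    "('b::finite_field \<Rightarrow> 'f::finite_field) \<Rightarrow> (nat \<Rightarrow> 'f) \<Rightarrow> 'f set \<Rightarrow> 'f \<Rightarrow> (nat \<Rightarrow> 'f poly) \<Rightarrow> nat"
where
  "io_cost \<iota> \<beta> A a g = (\<Sum>x\<in>A - {a}. nz (repair_matrix \<iota> \<beta> g x))"

definition repair_bandwidth ::
    "('b::finite_field \<Rightarrow> 'f::finite_field) \<Rightarrow> (nat \<Rightarrow> 'f) \<Rightarrow> 'f set \<Rightarrow> 'f \<Rightarrow> (nat \<Rightarrow> 'f poly) \<Rightarrow> nat"
where
  "repair_bandwidth \<iota> \<beta> A a g =
     (\<Sum>x\<in>A - {a}. vec_space.rank (ext_degree \<iota>) (repair_matrix \<iota> \<beta> g x))"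


lemma vector_space_ext_scale:
  assumes "field_hom \<iota>"
  shows "vector_space (ext_scale \<iota>)"
proof -
  interpret field_hom \<iota> by fact
  show ?thesis
    by standard (simp_all add: ext_scale_def hom_add hom_mult algebra_simps)
qed

lemma card_ext_degree:
  fixes \<iota> :: "'b::finite_field \<Rightarrow> 'f::finite_field"
  assumes "field_hom \<iota>"
  shows "CARD('f) = CARD('b) ^ ext_degree \<iota>"
proof -
  interpret V: vector_space "ext_scale \<iota>"
    using assms by (rule vector_space_ext_scale)
  obtain S where S: "\<not> V.dependent S" "V.span S = UNIV" "card S = ext_degree \<iota>"
    using V.basis_exists[of UNIV] unfolding ext_degree_def by (metis top.extremum_unique)
  define \<Phi> where "\<Phi> u = (\<Sum>v\<in>S. ext_scale \<iota> (u v) v)" for u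
  have inj: "inj_on \<Phi> (S \<rightarrow>\<^sub>E UNIV)"
  proof (rule inj_onI)
    fix u w assume u: "u \<in> S \<rightarrow>\<^sub>E UNIV" and w: "w \<in> S \<rightarrow>\<^sub>E UNIV" and eq: "\<Phi> u = \<Phi> w"
    have "(\<Sum>v\<in>S. ext_scale \<iota> (u v - w v) v) = 0"
      using eq unfolding \<Phi>_def by (simp add: V.scale_left_diff_distrib sum_subtractf)
    hence "u v - w v = 0" if "v \<in> S" for v
      using V.independentD[OF S(1) finite subset_refl, of "\<lambda>v. u v - w v" v] that by simp
    thus "u = w"
      using u w by (intro PiE_ext[of u S _ w]) auto
  qed
  have "\<Phi> ` (S \<rightarrow>\<^sub>E UNIV) = UNIV"
  proof -
    have "x \<in> \<Phi> ` (S \<rightarrow>\<^sub>E UNIV)" for x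
    proof -
      have "x \<in> range \<Phi>"
        using S(2) V.span_finite[of S] unfolding \<Phi>_def by auto
      then obtain u where "x = \<Phi> u" by blast
      hence "x = \<Phi> (restrict u S)"
        unfolding \<Phi>_def by simp
      thus ?thesis by auto
    qed
    thus ?thesis by blast
  qed
  hence "CARD('f) = card (S \<rightarrow>\<^sub>E (UNIV :: 'b set))"
    using card_image[OF inj] by simp
  thus ?thesis
    using S(3) by (simp add: card_funcsetE)
qed

lemma frobenius_add:
  fixes \<iota> :: "'b::finite_field \<Rightarrow> 'f::finite_field" and x y :: 'f
  assumes "field_hom \<iota>"
  shows "(x + y) ^ CARD('b) = x ^ CARD('b) + y ^ CARD('b)"
proof -
  interpret field_hom \<iota> by fact
  define q where "q = CARD('b)"
  have q: "q > 0" by (simp add: q_def)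
  define P :: "'b poly" where "P = [:1, 1:] ^ q - monom 1 q - 1"
  have coeff_P: "coeff P k = of_nat (q choose k)" if "0 < k" "k < q" for k
    using that by (simp add: P_def coeff_linear_poly_power)
  have "P = 0"
  proof (rule ccontr)
    assume "P \<noteq> 0"
    have "degree P < q"
    proof (rule degree_lessI)
      show "P \<noteq> 0 \<or> 0 < q" using q by simp
      show "\<forall>k\<ge>q. coeff P k = 0"
      proof (intro allI impI)
        fix k assume "q \<le> k"
        thus "coeff P k = 0"
          using q by (cases "k = q")
            (simp_all add: P_def coeff_linear_poly_power coeff_eq_0 degree_linear_power)
      qed
    qed
    moreover have "poly P x = 0" for x
      using finite_field_power_card_eq_same[of x] finite_field_power_card_eq_same[of "1 + x"]
      by (simp add: P_def poly_monom q_def poly_power)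
    hence "card {x. poly P x = 0} = q"
      by (simp add: q_def)
    ultimately show False
      using card_poly_roots_bound[OF \<open>P \<noteq> 0\<close>] by simp
  qed
  have choose: "of_nat (q choose k) = (0 :: 'f)" if "0 < k" "k < q" for k
  proof -
    have "of_nat (q choose k) = \<iota> (of_nat (q choose k))" by (simp add: hom_of_nat)
    also have "\<dots> = \<iota> 0" using coeff_P[OF that] \<open>P = 0\<close> by simp
    finally show ?thesis by simp
  qed
  have "(x + y) ^ q = (\<Sum>k\<le>q. of_nat (q choose k) * x ^ k * y ^ (q - k))"
    by (rule binomial_ring)
  also have "\<dots> = (\<Sum>k\<in>{0, q}. of_nat (q choose k) * x ^ k * y ^ (q - k))"
    by (rule sum.mono_neutral_right) (auto simp: choose)
  also have "\<dots> = x ^ q + y ^ q"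
    using q by (simp add: add.commute)
  finally show ?thesis by (simp add: q_def)
qed

lemma embed_trace:
  fixes \<iota> :: "'b::finite_field \<Rightarrow> 'f::finite_field"
  assumes "field_hom \<iota>"
  shows "\<iota> (trace \<iota> x) = (\<Sum>i<ext_degree \<iota>. x ^ (CARD('b) ^ i))"
proof -
  interpret field_hom \<iota> by fact
  define q where "q = CARD('b)"
  define e where "e = ext_degree \<iota>"
  define t where "t = (\<Sum>i<e. x ^ (q ^ i))"
  have q: "q > 1"
  proof -
    have "card {0, 1 :: 'b} \<le> q" unfolding q_def by (rule card_mono) auto
    thus ?thesis by simp
  qed
  have inj: "inj \<iota>"
  proof (rule injI)
    fix a b assume "\<iota> a = \<iota> b"
    hence "\<iota> (a - b) = 0" by (simp add: hom_minus)
    hence "\<iota> ((a - b) * inverse (a - b)) = 0" by (simp add: hom_mult)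
    thus "a = b" by (cases "a = b") auto
  qed
  have "(\<Sum>i\<in>I. f i) ^ q = (\<Sum>i\<in>I. f i ^ q)" for I :: "nat set" and f :: "nat \<Rightarrow> 'f"
    using q by (induction I rule: infinite_finite_induct)
      (auto simp: frobenius_add[OF assms, folded q_def])
  hence "t ^ q = (\<Sum>i<e. x ^ (q ^ Suc i))"
    by (simp add: t_def mult.commute flip: power_mult)
  also have "\<dots> = (\<Sum>i<Suc e. x ^ (q ^ i)) - x"
    by (subst sum.lessThan_Suc_shift) simp
  also have "\<dots> = t"
    using finite_field_power_card_eq_same[of x] card_ext_degree[OF assms]
    by (simp add: t_def q_def e_def)
  finally have t: "t ^ q = t" .
  define P :: "'f poly" where "P = monom 1 q - monom 1 1"
  have "coeff P q = 1" using q by (simp add: P_def)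
  hence P0: "P \<noteq> 0" by auto
  have "degree P \<le> q" unfolding P_def using q
    by (intro degree_diff_le order.trans[OF degree_monom_le]) auto
  hence "card {z. poly P z = 0} \<le> q"
    using card_poly_roots_bound[OF P0] by simp
  moreover have "range \<iota> \<subseteq> {z. poly P z = 0}"
    by (auto simp: P_def poly_monom q_def finite_field_power_card_eq_same simp flip: hom_power)
  moreover have "card (range \<iota>) = q"
    using card_image[OF inj] by (simp add: q_def)
  ultimately have "range \<iota> = {z. poly P z = 0}"
    by (intro card_subset_eq) (auto intro!: antisym card_mono)
  moreover have "poly P t = 0" using t by (simp add: P_def poly_monom)
  ultimately have "t \<in> range \<iota>" by blast
  thus ?thesis
    unfolding trace_def using f_the_inv_into_f[OF inj] by (simp add: t_def q_def e_def)
qed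

end

theory Submission
  imports Defs
begin

text \<open>
  For a node \<open>x\<close> put \<open>z = L(x) + 1\<close>. As \<open>\<beta>\<close> is dual to \<open>\<gamma>\<close>, the rows of the repair matrix with
  index above \<open>m\<close> are unit vectors, so only the leading block with entries
  \<open>Tr(z \<gamma>\<^sub>j \<beta>\<^sub>\<nu>)\<close>, \<open>j, \<nu> \<le> m\<close>, matters. The span \<open>U\<close> of \<open>\<beta>\<^sub>1, \<dots>, \<beta>\<^sub>m\<close> is one-dimensional over the
  field spanned by \<open>\<gamma>\<^sub>1, \<dots>, \<gamma>\<^sub>m\<close>; therefore the block vanishes if \<open>z\<close> is trace-orthogonal to \<open>U\<close>
  and is invertible otherwise. In both cases the rank equals the number of nonzero columns, which is
  \<open>l - m\<close> and \<open>l\<close>, respectively. For \<open>x \<in> A\<close> orthogonality means \<open>Tr(\<beta>\<^sub>1 L(x)) = -1\<close>, since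
  \<open>L(x) \<in> W\<close> takes care of \<open>\<beta>\<^sub>2, \<dots>, \<beta>\<^sub>m\<close> and \<open>\<gamma>\<^sub>1 = 1\<close>; this holds for \<open>q\<^bsup>d-1\<^esup>\<close> nodes.
\<close>

section \<open>Rank against nonzero columns, and counting fibres\<close>

text \<open>By hypothesis a linear relation among the columns has coefficient 0 at every nonzero
  column. So the nonzero columns are distinct and independent, and they form a maximal independent
  set of columns because only the zero vector could be added.\<close>

lemma (in vec_space) rank_eq_nz:
  assumes M: "M \<in> carrier_mat n nc"
    and indep: "\<And>c \<nu>. (\<And>j. j < n \<Longrightarrow> (\<Sum>\<mu><nc. c \<mu> * M $$ (j, \<mu>)) = 0) \<Longrightarrow>
      \<nu> < nc \<Longrightarrow> col M \<nu> \<noteq> 0\<^sub>v n \<Longrightarrow> c \<nu> = 0"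
  shows "rank M = nz M"
proof -
  define N where "N = {\<nu>. \<nu> < nc \<and> col M \<nu> \<noteq> 0\<^sub>v n}"
  have N: "finite N" "N \<subseteq> {..<nc}" by (auto simp: N_def)
  define S where "S = col M ` N"
  \<comment> \<open>A relation among the nonzero columns, extended by 0, is a relation among all
    columns.\<close>
  have key: "c \<nu> = 0" if "\<And>j. j < n \<Longrightarrow> (\<Sum>\<mu>\<in>N. c \<mu> * M $$ (j, \<mu>)) = 0" "\<nu> \<in> N" for c \<nu>
  proof -
    have "(\<Sum>\<mu><nc. (if \<mu> \<in> N then c \<mu> else 0) * M $$ (j, \<mu>)) = 0" if "j < n" for j
    proof -
      have "(\<Sum>\<mu><nc. (if \<mu> \<in> N then c \<mu> else 0) * M $$ (j, \<mu>)) = (\<Sum>\<mu>\<in>N. c \<mu> * M $$ (j, \<mu>))"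
        using N(2) by (intro sum.mono_neutral_cong_right) auto
      thus ?thesis using that \<open>\<And>j. j < n \<Longrightarrow> (\<Sum>\<mu>\<in>N. c \<mu> * M $$ (j, \<mu>)) = 0\<close> by simp
    qed
    from indep[OF this, of \<nu>] that(2) show ?thesis by (simp add: N_def)
  qed
  have inj: "inj_on (col M) N"
  proof (rule inj_onI, rule ccontr)
    fix \<mu> \<nu> assume mn: "\<mu> \<in> N" "\<nu> \<in> N" "col M \<mu> = col M \<nu>" "\<mu> \<noteq> \<nu>"
    \<comment> \<open>Two equal nonzero columns would satisfy the relation with coefficients 1 and
      -1. Distinctness matters because the rank counts a set of vectors, whereas \<open>nz\<close>
      counts indices.\<close>
    define c :: "nat \<Rightarrow> 'a" where "c = (\<lambda>i. if i = \<mu> then 1 else if i = \<nu> then -1 else 0)"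
    have "(\<Sum>i\<in>N. c i * M $$ (j, i)) = 0" if j: "j < n" for j
    proof -
      have "(\<Sum>i\<in>N. c i * M $$ (j, i)) = (\<Sum>i\<in>{\<mu>, \<nu>}. c i * M $$ (j, i))"
        using N(1) mn by (intro sum.mono_neutral_right) (auto simp: c_def)
      also have "\<dots> = M $$ (j, \<mu>) - M $$ (j, \<nu>)"
        using mn(4) by (simp add: c_def)
      also have "M $$ (j, \<mu>) = col M \<mu> $ j" using M mn(1) N(2) j by auto
      also have "\<dots> = M $$ (j, \<nu>)" unfolding mn(3) using M mn(2) N(2) j by auto
      finally show ?thesis by simp
    qed
    from key[OF this mn(1)] show False by (simp add: c_def)
  qed
  have S: "S \<subseteq> set (cols M)" "S \<subseteq> carrier_vec n" "finite S" "0\<^sub>v n \<notin> S"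
    using M N by (auto simp: S_def N_def cols_def)
  have ind: "lin_indpt S"
  proof (rule finite_lin_indpt2)
    fix a assume "lincomb a S = 0\<^sub>v n"
    hence *: "(\<Sum>v\<in>S. a v * v $ j) = 0" if "j < n" for j
      using lincomb_index[OF that S(2), of a] that by simp
    have "(\<Sum>\<mu>\<in>N. a (col M \<mu>) * M $$ (j, \<mu>)) = 0" if j: "j < n" for j
    proof -
      have "(\<Sum>\<mu>\<in>N. a (col M \<mu>) * M $$ (j, \<mu>)) = (\<Sum>\<mu>\<in>N. a (col M \<mu>) * col M \<mu> $ j)"
        using M N(2) j by (intro sum.cong) auto
      also have "\<dots> = (\<Sum>v\<in>S. a v * v $ j)"
        unfolding S_def by (subst sum.reindex[OF inj]) simp
      finally show ?thesis using *[OF j] by simp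
    qed
    from key[of "\<lambda>\<mu>. a (col M \<mu>)", OF this] show "\<forall>v\<in>S. a v = 0"
      by (auto simp: S_def)
  qed (use S in auto)
  have "maximal S (\<lambda>T. T \<subseteq> set (cols M) \<and> lin_indpt T)"
    unfolding maximal_def
  proof (intro conjI allI impI)
    fix T assume T: "S \<subseteq> T \<and> (T \<subseteq> set (cols M) \<and> lin_indpt T)"
    have "T \<subseteq> carrier_vec n" using T M cols_dim by blast
    moreover have "(UNIV :: 'a set) \<noteq> {0}" by (metis UNIV_I singletonD zero_neq_one)
    ultimately have "0\<^sub>v n \<notin> T" using T zero_nin_lin_indpt[of T] by auto
    moreover have "set (cols M) \<subseteq> insert (0\<^sub>v n) S"
      using M by (auto simp: S_def N_def cols_def)
    ultimately show "T = S" using T by blast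
  qed (use S ind in auto)
  hence "rank M = card S" by (rule rank_card_indpt[OF M])
  also have "\<dots> = card N" unfolding S_def by (rule card_image[OF inj])
  also have "\<dots> = nz M" using M by (simp add: nz_def N_def)
  finally show ?thesis .
qed

text \<open>Each fibre over a point of the range is a translate of the kernel.\<close>

lemma card_additive_vimage:
  fixes f :: "'a::{ab_group_add,finite} \<Rightarrow> 'c::ab_group_add"
  assumes add: "\<And>x y. f (x + y) = f x + f y" and Y: "Y \<subseteq> range f"
  shows "card {x. f x \<in> Y} = card Y * card {x. f x = 0}"
proof -
  have fib: "card {x. f x = y} = card {x. f x = 0}" if "y \<in> Y" for y
  proof -
    from that Y obtain a where a: "f a = y" by auto
    have "bij_betw (\<lambda>x. x + a) {x. f x = 0} {x. f x = y}"
    proof (rule bij_betwI[where g = "\<lambda>x. x - a"])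
      have "f (x - a) = f x - f a" for x
        using add[of "x - a" a] by simp
      thus "(\<lambda>x. x - a) \<in> {x. f x = y} \<rightarrow> {x. f x = 0}" using a by auto
    qed (auto simp: add a)
    thus ?thesis using bij_betw_same_card by metis
  qed
  have "finite Y" using Y by (rule finite_subset) simp
  have "{x. f x \<in> Y} = (\<Union>y\<in>Y. {x. f x = y})" by auto
  also have "card \<dots> = (\<Sum>y\<in>Y. card {x. f x = y})"
    using \<open>finite Y\<close> by (intro card_UN_disjoint) auto
  also have "\<dots> = card Y * card {x. f x = 0}" using fib by simp
  finally show ?thesis .
qed

section \<open>Linearity of the trace, and sizes of subspaces\<close>

lemma field_hom_inj: "field_hom \<iota> \<Longrightarrow> inj \<iota>"
  for \<iota> :: "'b::field \<Rightarrow> 'f::field"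
proof -
  assume "field_hom \<iota>"
  then interpret field_hom \<iota> .
  show ?thesis
  proof (rule injI)
    fix a b assume "\<iota> a = \<iota> b"
    hence "\<iota> ((a - b) * inverse (a - b)) = 0" by (simp add: hom_mult hom_minus)
    thus "a = b" by (cases "a = b") auto
  qed
qed

lemma field_hom_comp:
  assumes "field_hom \<epsilon>" "field_hom \<kappa>"
  shows "field_hom (\<kappa> \<circ> \<epsilon>)"
proof -
  interpret e: field_hom \<epsilon> by fact
  interpret k: field_hom \<kappa> by fact
  show ?thesis by standard (simp_all add: e.hom_add k.hom_add e.hom_mult k.hom_mult)
qed

lemma power_card_iter_add:
  fixes \<iota> :: "'b::finite_field \<Rightarrow> 'f::finite_field"
  assumes "field_hom \<iota>"
  shows "(x + y :: 'f) ^ (CARD('b) ^ i) = x ^ (CARD('b) ^ i) + y ^ (CARD('b) ^ i)"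
  by (induction i arbitrary: x y) (simp_all add: power_mult frobenius_add[OF assms])

lemma power_card_iter: "(c::'b::finite_field) ^ (CARD('b) ^ i) = c"
  by (induction i) (simp_all add: power_mult finite_field_power_card_eq_same)

lemma power_card_iter_scale:
  fixes \<iota> :: "'b::finite_field \<Rightarrow> 'f::finite_field"
  assumes "field_hom \<iota>"
  shows "(\<iota> c * x) ^ (CARD('b) ^ i) = \<iota> c * x ^ (CARD('b) ^ i)"
proof -
  interpret field_hom \<iota> by fact
  show ?thesis by (simp only: power_mult_distrib hom_power[symmetric] power_card_iter)
qed

lemma trace_add:
  fixes \<iota> :: "'b::finite_field \<Rightarrow> 'f::finite_field"
  assumes "field_hom \<iota>"
  shows "trace \<iota> (x + y) = trace \<iota> x + trace \<iota> y"
proof -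
  interpret field_hom \<iota> by fact
  show ?thesis
    \<comment> \<open>The trace is a pullback along the injective \<iota>, so the equation is
      checked in the larger field, on sums of conjugates.\<close>
    by (rule injD[OF field_hom_inj[OF assms]])
      (simp add: embed_trace[OF assms] hom_add power_card_iter_add[OF assms] sum.distrib)
qed

lemma trace_scale:
  fixes \<iota> :: "'b::finite_field \<Rightarrow> 'f::finite_field"
  assumes "field_hom \<iota>"
  shows "trace \<iota> (\<iota> c * x) = c * trace \<iota> x"
proof -
  interpret field_hom \<iota> by fact
  show ?thesis
    by (rule injD[OF field_hom_inj[OF assms]])
      (simp add: embed_trace[OF assms] hom_mult power_card_iter_scale[OF assms] sum_distrib_left)
qed

lemma trace_0: "field_hom \<iota> \<Longrightarrow> trace \<iota> 0 = 0"
  using trace_scale[of \<iota> 0 0] by simp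

lemma trace_sum: "field_hom \<iota> \<Longrightarrow> trace \<iota> (\<Sum>i\<in>I. f i) = (\<Sum>i\<in>I. trace \<iota> (f i))"
  by (induction I rule: infinite_finite_induct) (simp_all add: trace_0 trace_add)

text \<open>Coordinates in a basis of \<open>A\<close> give the count; the result is used to read
  the dimension of the evaluation set off its size.\<close>

lemma card_ext_subspace:
  fixes \<iota> :: "'b::finite_field \<Rightarrow> 'f::finite_field"
  assumes "field_hom \<iota>" and A: "Modules.module.subspace (ext_scale \<iota>) A"
  shows "card A = CARD('b) ^ Vector_Spaces.vector_space.dim (ext_scale \<iota>) A"
proof -
  interpret V: vector_space "ext_scale \<iota>"
    using assms(1) by (rule vector_space_ext_scale)
  obtain S where S: "S \<subseteq> A" "\<not> V.dependent S" "A \<subseteq> V.span S" "card S = V.dim A"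
    using V.basis_exists[of A] by metis
  define \<Phi> where "\<Phi> u = (\<Sum>v\<in>S. ext_scale \<iota> (u v) v)" for u
  have inj: "inj_on \<Phi> (S \<rightarrow>\<^sub>E UNIV)"
  proof (rule inj_onI)
    fix u w assume u: "u \<in> S \<rightarrow>\<^sub>E UNIV" and w: "w \<in> S \<rightarrow>\<^sub>E UNIV" and eq: "\<Phi> u = \<Phi> w"
    have "(\<Sum>v\<in>S. ext_scale \<iota> (u v - w v) v) = 0"
      using eq unfolding \<Phi>_def by (simp add: V.scale_left_diff_distrib sum_subtractf)
    hence "u v - w v = 0" if "v \<in> S" for v
      using V.independentD[OF S(2) finite subset_refl, of "\<lambda>v. u v - w v" v] that by simp
    thus "u = w"
      using u w by (intro PiE_ext[of u S _ w]) auto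
  qed
  have "\<Phi> ` (S \<rightarrow>\<^sub>E UNIV) = range \<Phi>"
  proof -
    have "\<Phi> u = \<Phi> (restrict u S)" for u unfolding \<Phi>_def by simp
    thus ?thesis by (auto intro!: image_eqI[of _ _ "restrict _ S"])
  qed
  also have "range \<Phi> = V.span S" unfolding \<Phi>_def by (rule V.span_finite[symmetric]) simp
  also have "\<dots> = A" using S V.span_minimal[OF S(1) A] by blast
  finally have "card A = card (S \<rightarrow>\<^sub>E (UNIV :: 'b set))"
    using card_image[OF inj] by simp
  thus ?thesis
    using S(4) by (simp add: card_funcsetE)
qed

lemma basis_family_expansion:
  fixes \<iota> :: "'b::field \<Rightarrow> 'f::field"
  assumes "field_hom \<iota>" "finite I" "basis_family \<iota> I v"
  obtains c where "x = (\<Sum>i\<in>I. \<iota> (c i) * v i)"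
proof -
  interpret V: vector_space "ext_scale \<iota>"
    using assms(1) by (rule vector_space_ext_scale)
  have inj: "inj_on v I" and "V.span (v ` I) = UNIV"
    using assms(3) by (auto simp: basis_family_def indep_family_def)
  hence "x \<in> range (\<lambda>u. \<Sum>w\<in>v ` I. ext_scale \<iota> (u w) w)"
    using V.span_finite[of "v ` I"] assms(2) by auto
  then obtain u where "x = (\<Sum>w\<in>v ` I. \<iota> (u w) * w)" by (auto simp: ext_scale_def)
  also have "\<dots> = (\<Sum>i\<in>I. \<iota> (u (v i)) * v i)"
    by (subst sum.reindex[OF inj]) simp
  finally show thesis by (rule that)
qed

section \<open>Coordinates from trace-dual families\<close>

text \<open>Only the dual pairing is assumed; that both families are bases follows by counting. The
  roles of \<gamma> and \<beta> are exchanged through \<open>swap\<close>.\<close>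

locale trace_dual_families =
  fixes \<iota> :: "'b::finite_field \<Rightarrow> 'f::finite_field" and l :: nat and \<gamma> \<beta> :: "nat \<Rightarrow> 'f"
  assumes hom: "field_hom \<iota>" and degree: "ext_degree \<iota> = l"
    and dual: "i \<in> {1..l} \<Longrightarrow> j \<in> {1..l} \<Longrightarrow> trace \<iota> (\<beta> i * \<gamma> j) = (if i = j then 1 else 0)"
begin

lemma swap: "trace_dual_families \<iota> l \<beta> \<gamma>"
  using dual by (intro trace_dual_families.intro hom degree) (subst mult.commute, auto)

lemma trace_comb:
  assumes "i \<in> {1..l}"
  shows "trace \<iota> (\<beta> i * (\<Sum>j\<in>{1..l}. \<iota> (c j) * \<gamma> j)) = c i"
proof -
  have "trace \<iota> (\<beta> i * (\<Sum>j\<in>{1..l}. \<iota> (c j) * \<gamma> j))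
      = (\<Sum>j\<in>{1..l}. trace \<iota> (\<iota> (c j) * (\<beta> i * \<gamma> j)))"
    by (simp add: sum_distrib_left trace_sum[OF hom] mult.left_commute)
  also have "\<dots> = (\<Sum>j\<in>{1..l}. if i = j then c j else 0)"
    using assms by (intro sum.cong) (simp_all add: trace_scale[OF hom] dual)
  also have "\<dots> = c i" using assms by simp
  finally show ?thesis .
qed

text \<open>Restricting to \<open>{1..l}\<close> makes the coordinate vector extensional, so that
  the target is a finite function space.\<close>

definition coords :: "'f \<Rightarrow> nat \<Rightarrow> 'b" where
  "coords x = (\<lambda>i\<in>{1..l}. trace \<iota> (\<beta> i * x))"

text \<open>Combinations of the \<gamma> with prescribed coefficients give surjectivity by duality;
  injectivity follows because both sides have the same size.\<close>

lemma coords_bij: "bij_betw coords UNIV ({1..l} \<rightarrow>\<^sub>E UNIV)"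
proof -
  have sub: "coords ` UNIV \<subseteq> {1..l} \<rightarrow>\<^sub>E UNIV" by (auto simp: coords_def)
  have "{1..l} \<rightarrow>\<^sub>E UNIV \<subseteq> range coords"
  proof
    fix c :: "nat \<Rightarrow> 'b" assume c: "c \<in> {1..l} \<rightarrow>\<^sub>E UNIV"
    hence "coords (\<Sum>j\<in>{1..l}. \<iota> (c j) * \<gamma> j) = c"
      by (intro PiE_ext[of _ "{1..l}" "\<lambda>_. UNIV"]) (simp_all only: coords_def restrict_apply' trace_comb, auto)
    thus "c \<in> range coords" by (metis rangeI)
  qed
  with sub have im: "range coords = {1..l} \<rightarrow>\<^sub>E UNIV" by blast
  have "card (range coords) = CARD('f)"
    unfolding im using card_ext_degree[OF hom] by (simp add: card_funcsetE degree)
  hence "inj coords" by (intro eq_card_imp_inj_on) auto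
  with im show ?thesis by (simp add: bij_betw_def)
qed

lemma trace_eqI:
  assumes "\<And>i. i \<in> {1..l} \<Longrightarrow> trace \<iota> (\<beta> i * x) = trace \<iota> (\<beta> i * y)"
  shows "x = y"
proof -
  have "coords x = coords y" using assms by (auto simp: coords_def)
  thus ?thesis using coords_bij by (auto simp: bij_betw_def inj_on_def)
qed

lemma expansion: "x = (\<Sum>i\<in>{1..l}. \<iota> (trace \<iota> (\<beta> i * x)) * \<gamma> i)"
  by (rule trace_eqI) (simp only: trace_comb)

text \<open>Each condition fixes one coordinate, and the remaining \<open>l - card I\<close> are
  free.\<close>

lemma card_trace_eq:
  assumes "I \<subseteq> {1..l}"
  shows "card {x. \<forall>i\<in>I. trace \<iota> (\<beta> i * x) = a i} = CARD('b) ^ (l - card I)"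
proof -
  let ?X = "\<lambda>i. if i \<in> I then {a i} else UNIV"
  have inj: "inj_on coords {x. \<forall>i\<in>I. trace \<iota> (\<beta> i * x) = a i}"
    using coords_bij by (auto simp: bij_betw_def inj_on_def)
  have im: "coords ` {x. \<forall>i\<in>I. trace \<iota> (\<beta> i * x) = a i} = PiE {1..l} ?X"
  proof (intro equalityI subsetI)
    fix c assume c: "c \<in> PiE {1..l} ?X"
    hence "c \<in> {1..l} \<rightarrow>\<^sub>E UNIV" by auto
    then obtain x where x: "c = coords x" using coords_bij unfolding bij_betw_def by blast
    have "trace \<iota> (\<beta> i * x) = a i" if "i \<in> I" for i
      using c that assms PiE_mem[OF c, of i] by (auto simp: x coords_def)
    with x show "c \<in> coords ` {x. \<forall>i\<in>I. trace \<iota> (\<beta> i * x) = a i}" by auto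
  qed (auto simp: coords_def)
  have "card {x. \<forall>i\<in>I. trace \<iota> (\<beta> i * x) = a i} = card (PiE {1..l} ?X)"
    using card_image[OF inj] unfolding im by (rule sym)
  also have "\<dots> = (\<Prod>i\<in>{1..l}. if i \<in> I then 1 else CARD('b))"
    by (subst card_PiE) (auto intro!: prod.cong)
  also have "\<dots> = CARD('b) ^ card ({1..l} - I)"
    by (subst prod.If_cases) (auto simp: Diff_eq)
  also have "card ({1..l} - I) = l - card I"
    using assms by (subst card_Diff_subset) (auto intro: finite_subset)
  finally show ?thesis .
qed

lemma indep_family: "indep_family \<iota> {1..l} \<gamma>"
proof -
  interpret V: vector_space "ext_scale \<iota>"
    using hom by (rule vector_space_ext_scale)
  have inj: "inj_on \<gamma> {1..l}"
    by (rule inj_onI) (metis dual zero_neq_one)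
  have "u v = 0" if "(\<Sum>w\<in>\<gamma> ` {1..l}. ext_scale \<iota> (u w) w) = 0" "v \<in> \<gamma> ` {1..l}" for u v
  proof -
    obtain i where i: "i \<in> {1..l}" "v = \<gamma> i" using \<open>v \<in> _\<close> by blast
    have "(\<Sum>j\<in>{1..l}. \<iota> (u (\<gamma> j)) * \<gamma> j) = 0"
      using that(1) by (subst (asm) sum.reindex[OF inj]) (simp add: ext_scale_def)
    thus ?thesis using trace_comb[OF i(1), of "\<lambda>j. u (\<gamma> j)"] trace_0[OF hom] i by simp
  qed
  hence "\<not> V.dependent (\<gamma> ` {1..l})"
    by (subst V.dependent_finite) auto
  with inj show ?thesis by (simp add: indep_family_def)
qed

lemma basis_family: "basis_family \<iota> {1..l} \<gamma>"
proof -
  interpret V: vector_space "ext_scale \<iota>"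
    using hom by (rule vector_space_ext_scale)
  have "x \<in> V.span (\<gamma> ` {1..l})" for x
  proof -
    have "(\<Sum>i\<in>{1..l}. ext_scale \<iota> (trace \<iota> (\<beta> i * x)) (\<gamma> i)) \<in> V.span (\<gamma> ` {1..l})"
      by (intro V.span_sum V.span_scale V.span_base imageI)
    thus ?thesis using expansion[of x] by (simp add: ext_scale_def)
  qed
  thus ?thesis using indep_family by (auto simp: basis_family_def)
qed

end

section \<open>The field tower and the block structure of the repair matrix\<close>

text \<open>The type \<open>'e\<close> is the intermediate field of order q^m. The i-th block of m
  elements of \<gamma> spans the \<open>'e\<close>-line through \<open>lam i\<close>; as
  \<open>lam 1 = 1\<close>, the first block spans the copy of \<open>'e\<close> itself.\<close>

locale tower_dual_families = trace_dual_families "\<kappa> \<circ> \<epsilon>" l \<gamma> \<beta>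
  for \<epsilon> :: "'b::finite_field \<Rightarrow> 'e::finite_field" and \<kappa> :: "'e \<Rightarrow> 'f::finite_field"
    and l :: nat and \<gamma> \<beta> :: "nat \<Rightarrow> 'f" +
  fixes m :: nat and \<gamma>\<^sub>E :: "nat \<Rightarrow> 'e" and lam :: "nat \<Rightarrow> 'f"
  assumes hom_\<epsilon>: "field_hom \<epsilon>" and hom_\<kappa>: "field_hom \<kappa>"
    and card_E: "CARD('e) = CARD('b) ^ m"
    and m_pos: "0 < m" and m_dvd: "m dvd l" and l_pos: "0 < l"
    and basis_E: "basis_family \<epsilon> {1..m} \<gamma>\<^sub>E" and lam_1: "lam 1 = 1"
    and \<gamma>_eq: "i \<in> {1..l div m} \<Longrightarrow> j \<in> {1..m} \<Longrightarrow> \<gamma> ((i - 1) * m + j) = lam i * \<kappa> (\<gamma>\<^sub>E j)"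
begin

interpretation \<kappa>: field_hom \<kappa> by (rule hom_\<kappa>)

abbreviation \<tau> :: "'f \<Rightarrow> 'b" where "\<tau> \<equiv> trace (\<kappa> \<circ> \<epsilon>)"

lemma m_le: "m \<le> l"
  using m_dvd l_pos by (rule dvd_imp_le)

lemma \<gamma>_head: "j \<in> {1..m} \<Longrightarrow> \<gamma> j = \<kappa> (\<gamma>\<^sub>E j)"
  using \<gamma>_eq[of 1 j] lam_1 m_le m_pos by (simp add: div_greater_zero_iff Suc_le_eq)

lemma expansion_E:
  obtains c where "\<kappa> e = (\<Sum>j\<in>{1..m}. \<kappa> (\<epsilon> (c j)) * \<kappa> (\<gamma>\<^sub>E j))"
proof -
  obtain c where "e = (\<Sum>j\<in>{1..m}. \<epsilon> (c j) * \<gamma>\<^sub>E j)"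
    by (rule basis_family_expansion[OF hom_\<epsilon> _ basis_E]) auto
  hence "\<kappa> e = (\<Sum>j\<in>{1..m}. \<kappa> (\<epsilon> (c j)) * \<kappa> (\<gamma>\<^sub>E j))"
    by (simp only: \<kappa>.hom_sum \<kappa>.hom_mult)
  thus thesis by (rule that)
qed

lemma trace_sum_scale: "\<tau> (\<Sum>j\<in>I. \<kappa> (\<epsilon> (c j)) * f j) = (\<Sum>j\<in>I. c j * \<tau> (f j))"
  using trace_scale[OF hom] by (simp add: trace_sum[OF hom])

text \<open>
  This is the \<open>'b\<close>-span of \<open>\<beta> 1, \<dots>, \<beta> m\<close>. The elements \<open>\<gamma> (m + 1), \<dots>, \<gamma> l\<close> span an
  \<open>'e\<close>-subspace, hence their annihilator is one as well; by cardinality it is an \<open>'e\<close>-line.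
\<close>

definition line :: "'f set" where
  "line = {u. \<forall>j\<in>{m+1..l}. \<tau> (\<gamma> j * u) = 0}"

lemma line_scale:
  assumes u: "u \<in> line"
  shows "\<kappa> e * u \<in> line"
  unfolding line_def
proof (rule CollectI, rule ballI)
  fix k assume k: "k \<in> {m+1..l}"
  \<comment> \<open>Block number and position of \<open>k\<close>, both counted from 1. As k > m,
    the block is not the first, so all of it lies in the index range that defines
    \<open>line\<close>.\<close>
  define i j where "i = (k - 1) div m + 1" and "j = (k - 1) mod m + 1"
  have "(k - 1) div m < l div m"
    using k m_dvd m_pos by (intro less_mult_imp_div_less) auto
  moreover have "m \<le> k - 1" using k by auto
  hence "1 \<le> (k - 1) div m"
    using m_pos by (simp add: div_greater_zero_iff Suc_le_eq)
  ultimately have i: "i \<in> {2..l div m}" by (auto simp: i_def)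
  have j: "j \<in> {1..m}" using m_pos by (auto simp: j_def Suc_le_eq)
  have k_eq: "k = (i - 1) * m + j" using k by (simp add: i_def j_def)
  have \<gamma>: "\<gamma> ((i - 1) * m + j') = lam i * \<kappa> (\<gamma>\<^sub>E j')" if "j' \<in> {1..m}" for j'
    using i that by (intro \<gamma>_eq) auto
  have tail: "(i - 1) * m + j' \<in> {m+1..l}" if "j' \<in> {1..m}" for j'
  proof -
    have "1 * m \<le> (i - 1) * m" using i by (intro mult_right_mono) auto
    moreover have "i * m \<le> l div m * m" using i by (intro mult_right_mono) auto
    moreover have "i * m = (i - 1) * m + m" using i by (cases i) auto
    ultimately show ?thesis using that m_dvd unfolding atLeastAtMost_iff
      by (simp only: dvd_div_mult_self) linarith
  qed
  \<comment> \<open>Multiplying by e stays inside the block: the product is expanded again in the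
    basis of \<open>'e\<close>.\<close>
  obtain c where c: "\<kappa> (\<gamma>\<^sub>E j * e) = (\<Sum>j'\<in>{1..m}. \<kappa> (\<epsilon> (c j')) * \<kappa> (\<gamma>\<^sub>E j'))"
    by (rule expansion_E)
  have "\<gamma> k * (\<kappa> e * u) = lam i * \<kappa> (\<gamma>\<^sub>E j * e) * u"
    unfolding k_eq \<gamma>[OF j] by (simp add: \<kappa>.hom_mult)
  also have "\<dots> = (\<Sum>j'\<in>{1..m}. \<kappa> (\<epsilon> (c j')) * (\<gamma> ((i - 1) * m + j') * u))"
    unfolding c sum_distrib_left sum_distrib_right using \<gamma> by (intro sum.cong) (simp_all add: mult_ac)
  also have "\<tau> \<dots> = (\<Sum>j'\<in>{1..m}. c j' * \<tau> (\<gamma> ((i - 1) * m + j') * u))"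
    by (rule trace_sum_scale)
  also have "\<dots> = 0"
    using u tail unfolding line_def by (intro sum.neutral) auto
  finally show "\<tau> (\<gamma> k * (\<kappa> e * u)) = 0" .
qed

text \<open>In coordinates with respect to \<beta>, \<open>line\<close> is cut out by l - m
  conditions, which leaves m free coordinates.\<close>

lemma card_line: "card line = CARD('b) ^ m"
  using trace_dual_families.card_trace_eq[OF swap, of "{m+1..l}" "\<lambda>_. 0"] m_le
  by (simp add: line_def)

lemma \<beta>_in_line: "i \<in> {1..m} \<Longrightarrow> \<beta> i \<in> line"
  using dual m_le by (auto simp: line_def) (subst mult.commute, auto)

text \<open>The \<beta>-coordinates of u with index above m vanish, so u is a combination of \<beta>
  1, ..., \<beta> m.\<close>

lemma trace_line_eq_0:
  assumes u: "u \<in> line" and z: "\<And>i. i \<in> {1..m} \<Longrightarrow> \<tau> (\<beta> i * z) = 0"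
  shows "\<tau> (u * z) = 0"
proof -
  have "u * z = (\<Sum>i\<in>{1..l}. \<kappa> (\<epsilon> (\<tau> (\<gamma> i * u))) * \<beta> i) * z"
    using trace_dual_families.expansion[OF swap, of u] by simp
  also have "\<dots> = (\<Sum>i\<in>{1..l}. \<kappa> (\<epsilon> (\<tau> (\<gamma> i * u))) * (\<beta> i * z))"
    by (simp only: sum_distrib_right mult.assoc)
  also have "\<tau> \<dots> = (\<Sum>i\<in>{1..l}. \<tau> (\<gamma> i * u) * \<tau> (\<beta> i * z))"
    by (rule trace_sum_scale)
  also have "\<dots> = 0"
  proof (rule sum.neutral, rule ballI)
    fix i assume "i \<in> {1..l}"
    thus "\<tau> (\<gamma> i * u) * \<tau> (\<beta> i * z) = 0"
      using u z by (cases "i \<le> m") (auto simp: line_def)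
  qed
  finally show ?thesis .
qed

text \<open>A nonzero u generates the whole line over \<open>'e\<close>, so v = \<kappa> e * u;
  expanding e in the basis of \<open>'e\<close> writes v * z as a combination of the z * \<gamma> j
  * u.\<close>

lemma line_orthogonal:
  assumes u: "u \<in> line" "u \<noteq> 0" and orth: "\<And>j. j \<in> {1..m} \<Longrightarrow> \<tau> (z * \<gamma> j * u) = 0"
    and v: "v \<in> line"
  shows "\<tau> (v * z) = 0"
proof -
  \<comment> \<open>The \<open>'e\<close>-multiples of u are pairwise distinct, lie in the line, and
    are as many as its q^m elements.\<close>
  have "inj (\<lambda>e. \<kappa> e * u)"
    using u(2) field_hom_inj[OF hom_\<kappa>] by (auto simp: inj_on_def)
  hence "card (range (\<lambda>e. \<kappa> e * u)) = card line"
    by (simp add: card_image card_E card_line)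
  moreover have "range (\<lambda>e. \<kappa> e * u) \<subseteq> line"
    using line_scale[OF u(1)] by auto
  ultimately have "range (\<lambda>e. \<kappa> e * u) = line"
    by (intro card_subset_eq) auto
  with v obtain e where e: "v = \<kappa> e * u" by auto
  obtain c where c: "\<kappa> e = (\<Sum>j\<in>{1..m}. \<kappa> (\<epsilon> (c j)) * \<kappa> (\<gamma>\<^sub>E j))"
    by (rule expansion_E)
  have "v * z = (\<Sum>j\<in>{1..m}. \<kappa> (\<epsilon> (c j)) * (z * \<gamma> j * u))"
    unfolding e c by (simp add: sum_distrib_left sum_distrib_right \<gamma>_head mult_ac)
  also have "\<tau> \<dots> = (\<Sum>j\<in>{1..m}. c j * \<tau> (z * \<gamma> j * u))"
    by (rule trace_sum_scale)
  also have "\<dots> = 0" using orth by simp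
  finally show ?thesis .
qed

text \<open>This is the repair matrix at a node x with z = L(x) + 1, freed from the polynomials; row
  j belongs to the polynomial with index j + 1.\<close>

definition block_matrix :: "'f \<Rightarrow> 'b mat" where
  "block_matrix z =
     mat l l (\<lambda>(j, \<nu>). \<tau> ((if j < m then z else 1) * \<gamma> (Suc j) * \<beta> (Suc \<nu>)))"

lemma block_matrix_carrier: "block_matrix z \<in> carrier_mat l l"
  by (simp add: block_matrix_def)

lemma block_matrix_upper:
  "j < m \<Longrightarrow> \<nu> < l \<Longrightarrow> block_matrix z $$ (j, \<nu>) = \<tau> (z * \<gamma> (Suc j) * \<beta> (Suc \<nu>))"
  using m_le by (simp add: block_matrix_def)

lemma block_matrix_lower:
  "m \<le> j \<Longrightarrow> j < l \<Longrightarrow> \<nu> < l \<Longrightarrow> block_matrix z $$ (j, \<nu>) = (if j = \<nu> then 1 else 0)"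
  using dual[of "Suc \<nu>" "Suc j"] by (auto simp: block_matrix_def mult.commute)

text \<open>From index m on, a column has a 1 on the diagonal. Among the first m, one zero column
  already makes z orthogonal to the whole line, since \<open>\<beta> (Suc \<nu>)\<close> generates
  it; so these columns vanish all together or not at all.\<close>

lemma col_block_matrix_eq_0_iff:
  assumes \<nu>: "\<nu> < l"
  shows "col (block_matrix z) \<nu> = 0\<^sub>v l \<longleftrightarrow> \<nu> < m \<and> (\<forall>i\<in>{1..m}. \<tau> (\<beta> i * z) = 0)"
proof -
  have col_0: "col (block_matrix z) \<nu> = 0\<^sub>v l \<longleftrightarrow> (\<forall>j<l. block_matrix z $$ (j, \<nu>) = 0)"
    using \<nu> block_matrix_carrier[of z] by (auto simp: vec_eq_iff)
  show ?thesis
  proof (cases "\<nu> < m")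
    case False
    thus ?thesis using \<nu> col_0 block_matrix_lower[of \<nu> \<nu> z] by auto
  next
    case True
    hence line: "\<beta> (Suc \<nu>) \<in> line" by (intro \<beta>_in_line) auto
    have ne: "\<beta> (Suc \<nu>) \<noteq> 0"
      using dual[of "Suc \<nu>" "Suc \<nu>"] \<nu> trace_0[OF hom] by auto
    show ?thesis
    proof
      assume "col (block_matrix z) \<nu> = 0\<^sub>v l"
      hence 0: "block_matrix z $$ (j, \<nu>) = 0" if "j < l" for j
        using col_0 that by blast
      have "\<tau> (z * \<gamma> j * \<beta> (Suc \<nu>)) = 0" if "j \<in> {1..m}" for j
        using 0[of "j - 1"] block_matrix_upper[of "j - 1" \<nu> z] that m_le \<nu> by (cases j) auto
      hence "\<tau> (v * z) = 0" if "v \<in> line" for v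
        using line_orthogonal[OF line ne _ that] by blast
      with True \<beta>_in_line show "\<nu> < m \<and> (\<forall>i\<in>{1..m}. \<tau> (\<beta> i * z) = 0)" by blast
    next
      assume "\<nu> < m \<and> (\<forall>i\<in>{1..m}. \<tau> (\<beta> i * z) = 0)"
      hence z: "\<tau> (\<beta> i * z) = 0" if "i \<in> {1..m}" for i using that by blast
      have "block_matrix z $$ (j, \<nu>) = 0" if j: "j < l" for j
      proof (cases "j < m")
        case True
        \<comment> \<open>For j < m the factor \<open>\<gamma> (Suc j)\<close> comes from
          \<open>'e\<close>, and the line is closed under such multiples.\<close>
        have "\<gamma> (Suc j) * \<beta> (Suc \<nu>) \<in> line"
          using \<gamma>_head[of "Suc j"] True line_scale[OF line, of "\<gamma>\<^sub>E (Suc j)"] by simp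
        hence "\<tau> (\<gamma> (Suc j) * \<beta> (Suc \<nu>) * z) = 0"
          by (rule trace_line_eq_0) (rule z)
        thus ?thesis using block_matrix_upper[OF True \<nu>, of z] by (simp add: mult_ac)
      next
        case False
        thus ?thesis using block_matrix_lower[of j \<nu> z] \<open>\<nu> < m\<close> j \<nu> by auto
      qed
      thus "col (block_matrix z) \<nu> = 0\<^sub>v l" using col_0 by blast
    qed
  qed
qed

lemma nz_block_matrix:
  "nz (block_matrix z) = (if \<forall>i\<in>{1..m}. \<tau> (\<beta> i * z) = 0 then l - m else l)"
proof -
  have "{\<nu>. \<nu> < dim_col (block_matrix z) \<and> col (block_matrix z) \<nu> \<noteq> 0\<^sub>v (dim_row (block_matrix z))}
      = (if \<forall>i\<in>{1..m}. \<tau> (\<beta> i * z) = 0 then {m..<l} else {..<l})"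
    using block_matrix_carrier[of z] col_block_matrix_eq_0_iff[of _ z] by auto
  thus ?thesis by (simp add: nz_def)
qed

text \<open>A kernel vector c is read as the element u with \<beta>-coordinates c. The unit rows put
  u into \<open>line\<close>; the first m rows say that z annihilates all \<gamma> j * u. If u were
  nonzero, z would be orthogonal to the line and the first m columns would vanish.\<close>

lemma rank_block_matrix: "vec_space.rank l (block_matrix z) = nz (block_matrix z)"
proof (rule vec_space.rank_eq_nz[OF block_matrix_carrier])
  fix c \<nu>
  assume ker: "\<And>j. j < l \<Longrightarrow> (\<Sum>\<mu><l. c \<mu> * block_matrix z $$ (j, \<mu>)) = 0"
    and \<nu>: "\<nu> < l" and col: "col (block_matrix z) \<nu> \<noteq> 0\<^sub>v l"
  define u where "u = (\<Sum>i\<in>{1..l}. \<kappa> (\<epsilon> (c (i - 1))) * \<beta> i)"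
  have coord: "\<tau> (\<gamma> i * u) = c (i - 1)" if "i \<in> {1..l}" for i
    using trace_dual_families.trace_comb[OF swap that, of "\<lambda>i. c (i - 1)"] by (simp add: u_def)
  have tail: "c j = 0" if "m \<le> j" "j < l" for j
  proof -
    have "(\<Sum>\<mu><l. c \<mu> * block_matrix z $$ (j, \<mu>)) = (\<Sum>\<mu><l. if j = \<mu> then c \<mu> else 0)"
      using that by (intro sum.cong) (auto simp: block_matrix_lower)
    thus ?thesis using ker[of j] that by simp
  qed
  show "c \<nu> = 0"
  proof (cases "\<nu> < m")
    case True
    hence "\<not> (\<forall>i\<in>{1..m}. \<tau> (\<beta> i * z) = 0)"
      using col col_block_matrix_eq_0_iff[OF \<nu>] by blast
    then obtain i where i: "i \<in> {1..m}" "\<tau> (\<beta> i * z) \<noteq> 0" by blast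
    have "u \<in> line" using coord tail by (auto simp: line_def)
    moreover have "\<tau> (z * \<gamma> j * u) = 0" if j: "j \<in> {1..m}" for j
    proof -
      have "z * \<gamma> j * u = (\<Sum>i\<in>{1..l}. \<kappa> (\<epsilon> (c (i - 1))) * (z * \<gamma> j * \<beta> i))"
        by (simp add: u_def sum_distrib_left mult.left_commute)
      also have "\<tau> \<dots> = (\<Sum>i\<in>{1..l}. c (i - 1) * \<tau> (z * \<gamma> j * \<beta> i))"
        by (rule trace_sum_scale)
      also have "\<dots> = (\<Sum>\<mu><l. c \<mu> * block_matrix z $$ (j - 1, \<mu>))"
        \<comment> \<open>Shifts from family indices starting at 1 to matrix indices starting at
          0.\<close>
        unfolding One_nat_def sum.atLeast1_atMost_eq
        using j by (intro sum.cong) (auto simp: block_matrix_upper)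
      also have "\<dots> = 0" using ker[of "j - 1"] j m_le by auto
      finally show ?thesis .
    qed
    ultimately have "u = 0"
      using line_orthogonal[of u z "\<beta> i"] i \<beta>_in_line by blast
    thus ?thesis using coord[of "Suc \<nu>"] \<nu> trace_0[OF hom] by simp
  qed (use tail \<nu> in auto)
qed

end

section \<open>The construction: sizes, validity of the scheme and cost\<close>

text \<open>Turns the sets of the construction into systems of trace conditions, which
  \<open>card_trace_eq\<close> counts.\<close>

lemma INT_scaled_trace_kernel:
  assumes "\<And>i. i \<in> I \<Longrightarrow> \<beta> i \<noteq> 0"
  shows "(\<Inter>i\<in>I. (\<lambda>x. inverse (\<beta> i) * x) ` trace_kernel \<iota>) = {y. \<forall>i\<in>I. trace \<iota> (\<beta> i * y) = 0}"
proof -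
  have "(\<lambda>x. inverse b * x) ` trace_kernel \<iota> = {y. trace \<iota> (b * y) = 0}" if "b \<noteq> 0" for b
  proof (intro equalityI subsetI)
    fix y assume "y \<in> {y. trace \<iota> (b * y) = 0}"
    hence "b * y \<in> trace_kernel \<iota>" by (simp add: trace_kernel_def)
    moreover have "y = inverse b * (b * y)" using that by simp
    ultimately show "y \<in> (\<lambda>x. inverse b * x) ` trace_kernel \<iota>" by blast
  qed (use that in \<open>auto simp: trace_kernel_def mult.assoc[symmetric]\<close>)
  thus ?thesis using assms by auto
qed

lemma card_finite_field_gt_1: "1 < CARD('a::finite_field)"
proof -
  have "card {0, 1 :: 'a} \<le> CARD('a)" by (rule card_mono) auto
  thus ?thesis by simp
qed

theorem theorem22:
  fixes \<epsilon> :: "'b::finite_field \<Rightarrow> 'e::finite_field"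
    and \<kappa> :: "'e \<Rightarrow> 'f::finite_field"
    and \<iota> :: "'b \<Rightarrow> 'f"
    and q l d s r m n :: nat
    and \<gamma>\<^sub>E :: "nat \<Rightarrow> 'e"
    and lam \<gamma> \<beta> \<theta> :: "nat \<Rightarrow> 'f"
    and L :: "'f poly"
    and W A :: "'f set"
    and g :: "nat \<Rightarrow> 'f poly"
  assumes "field_hom \<epsilon>" and "field_hom \<kappa>" and "\<iota> = \<kappa> \<circ> \<epsilon>"
    and "CARD('b) = q" and "CARD('e) = q ^ m" and "CARD('f) = q ^ l"
    and "1 < l" and "d < l"
    and "q ^ s + 1 \<le> r" and "r < q ^ d"
    and "0 < m" and "m \<le> l - d + s + 1" and "m dvd l"
    and "n = q ^ d"
    and "basis_family \<epsilon> {1..m} \<gamma>\<^sub>E" and "\<gamma>\<^sub>E 1 = 1"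
    and "basis_family \<kappa> {1..l div m} lam" and "lam 1 = 1"
    and "\<And>i j. i \<in> {1..l div m} \<Longrightarrow> j \<in> {1..m} \<Longrightarrow> \<gamma> ((i - 1) * m + j) = lam i * \<kappa> (\<gamma>\<^sub>E j)"
    and "\<And>i j. i \<in> {1..l} \<Longrightarrow> j \<in> {1..l} \<Longrightarrow>
           trace \<iota> (\<beta> i * \<gamma> j) = (if i = j then 1 else 0)"
    and "s = 0 \<Longrightarrow> \<exists>\<alpha>. \<alpha> \<noteq> 0 \<and> L = [:0, \<alpha>:]"
    and "0 < s \<Longrightarrow> L = (\<Sum>j\<le>s. monom (\<theta> j) (q ^ j)) \<and> \<theta> s \<noteq> 0 \<and>
           range (poly L) = (\<Inter>i\<in>{2..s + 1}. (\<lambda>x. inverse (\<beta> i) * x) ` trace_kernel \<iota>)"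
    and "W = (\<Inter>i\<in>{2..l - d + s + 1}. (\<lambda>x. inverse (\<beta> i) * x) ` trace_kernel \<iota>)"
    and "A = {x. poly L x \<in> W}"
    and "\<And>j. j \<in> {1..m} \<Longrightarrow> g j = Polynomial.smult (\<gamma> j) L + [:\<gamma> j:]"
    and "\<And>j. j \<in> {m + 1..l} \<Longrightarrow> g j = [:\<gamma> j:]"
  shows "basis_family \<iota> {1..l} \<beta>
    \<and> Modules.module.subspace (ext_scale \<iota>) A \<and> Vector_Spaces.vector_space.dim (ext_scale \<iota>) A = d
    \<and> linear_repair_scheme \<iota> A (q ^ d - r) 0 g
    \<and> int (io_cost \<iota> \<beta> A 0 g) = (int n - 1) * int l - int m * int q ^ (d - 1)
    \<and> repair_bandwidth \<iota> \<beta> A 0 g = io_cost \<iota> \<beta> A 0 g"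
proof -
  note A = assms
  have q1: "1 < q" using card_finite_field_gt_1[where 'a = 'b] A(4) by simp
  have hom_\<iota>: "field_hom \<iota>" unfolding A(3) by (rule field_hom_comp[OF A(1,2)])
  interpret \<kappa>: field_hom \<kappa> by (rule A(2))
  interpret \<iota>: field_hom \<iota> by (rule hom_\<iota>)
  interpret V: vector_space "ext_scale \<iota>" using hom_\<iota> by (rule vector_space_ext_scale)
  have "q ^ l = q ^ ext_degree \<iota>" using card_ext_degree[OF hom_\<iota>] A(4,6) by simp
  hence deg: "ext_degree \<iota> = l" using q1 by (simp add: power_inject_exp)
  interpret tower_dual_families \<epsilon> \<kappa> l \<gamma> \<beta> m \<gamma>\<^sub>E lam
  proof (intro tower_dual_families.intro trace_dual_families.intro tower_dual_families_axioms.intro)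
    show "ext_degree (\<kappa> \<circ> \<epsilon>) = l" using deg A(3) by simp
    show "field_hom (\<kappa> \<circ> \<epsilon>)" using hom_\<iota> A(3) by simp
    show "trace (\<kappa> \<circ> \<epsilon>) (\<beta> i * \<gamma> j) = (if i = j then 1 else 0)"
      if "i \<in> {1..l}" "j \<in> {1..l}" for i j
      using A(20)[OF that] by (simp only: A(3))
  qed (use A in auto)
  note \<iota>_eq = A(3)[symmetric]
  have dual': "trace \<iota> (\<beta> i * \<gamma> j) = (if i = j then 1 else 0)" if "i \<in> {1..l}" "j \<in> {1..l}" for i j
    using A(20) that .
  note card_trace_eq = card_trace_eq[unfolded \<iota>_eq A(4)]
  have \<gamma>_1: "\<gamma> 1 = 1"
    using \<gamma>_head[of 1] A(11,16) \<kappa>.hom_one by simp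

  \<comment> \<open>The bounds on r give s < d, so none of the natural-number differences below is
    truncated.\<close>
  have "q ^ s < q ^ d" using A(9,10) by simp
  hence sd: "s < d" using q1 by simp
  \<comment> \<open>The last index in the definition of \<open>W\<close>, which therefore imposes p
    - 1 conditions.\<close>
  define p where "p = l - d + s + 1"
  have p: "p \<le> l" "s + 1 \<le> p" "l - (p - 1) = d - s" "l - p = d - 1 - s" "m \<le> p"
    using sd A(8,12) by (auto simp: p_def)
  have \<beta>_ne: "\<beta> i \<noteq> 0" if "i \<in> {1..l}" for i
    using dual'[OF that that] trace_0[OF hom_\<iota>] by auto
  have W: "W = {y. \<forall>i\<in>{2..p}. trace \<iota> (\<beta> i * y) = 0}"
    using p \<beta>_ne unfolding A(23) p_def[symmetric] by (intro INT_scaled_trace_kernel) auto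

  \<comment> \<open>These facts treat both shapes of L alike; for s = 0 the list of conditions on
    the image is empty and L is onto.\<close>
  have L_add: "poly L (x + y) = poly L x + poly L y"
    and L_scale: "poly L (\<iota> c * x) = \<iota> c * poly L x"
    and L_degree: "degree L \<le> q ^ s"
    and L_range: "range (poly L) = {y. \<forall>i\<in>{2..s + 1}. trace \<iota> (\<beta> i * y) = 0}" for x y c
  proof -
    show "poly L (x + y) = poly L x + poly L y"
    proof (cases "s = 0")
      case True
      thus ?thesis using A(21) by (auto simp: algebra_simps)
    next
      case False
      hence "L = (\<Sum>j\<le>s. monom (\<theta> j) (q ^ j))" using A(22) by blast
      thus ?thesis
        using power_card_iter_add[OF hom_\<iota>, unfolded A(4)]
        by (simp add: poly_sum poly_monom sum.distrib distrib_left)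
    qed
    show "poly L (\<iota> c * x) = \<iota> c * poly L x"
    proof (cases "s = 0")
      case True
      thus ?thesis using A(21) by (auto simp: algebra_simps)
    next
      case False
      hence "L = (\<Sum>j\<le>s. monom (\<theta> j) (q ^ j))" using A(22) by blast
      thus ?thesis
        using power_card_iter_scale[OF hom_\<iota>, unfolded A(4)]
        by (simp add: poly_sum poly_monom sum_distrib_left mult.left_commute)
    qed
    show "degree L \<le> q ^ s"
    proof (cases "s = 0")
      case True
      thus ?thesis using A(21) by auto
    next
      case False
      hence L: "L = (\<Sum>j\<le>s. monom (\<theta> j) (q ^ j))" using A(22) by blast
      show ?thesis
        unfolding L using q1
        by (intro degree_sum_le order.trans[OF degree_monom_le] power_increasing) auto
    qed
    show "range (poly L) = {y. \<forall>i\<in>{2..s + 1}. trace \<iota> (\<beta> i * y) = 0}"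
    proof (cases "s = 0")
      case True
      then obtain \<alpha> where \<alpha>: "\<alpha> \<noteq> 0" "L = [:0, \<alpha>:]" using A(21) by blast
      have "y \<in> range (poly L)" for y
        using \<alpha> by (intro image_eqI[of _ _ "y / \<alpha>"]) auto
      with True show ?thesis by auto
    next
      case False
      then have "range (poly L) = (\<Inter>i\<in>{2..s + 1}. (\<lambda>x. inverse (\<beta> i) * x) ` trace_kernel \<iota>)"
        using A(22) by blast
      also have "\<dots> = {y. \<forall>i\<in>{2..s + 1}. trace \<iota> (\<beta> i * y) = 0}"
        using p \<beta>_ne by (intro INT_scaled_trace_kernel) auto
      finally show ?thesis .
    qed
  qed
  have L_0: "poly L 0 = 0" using L_scale[of 0 0] by simp

  have card_range: "card (range (poly L)) = q ^ (l - s)"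
    using p card_trace_eq[of "{2..s + 1}" "\<lambda>_. 0"] by (simp add: L_range)
  \<comment> \<open>The preimage of the range is the whole field, so comparing sizes yields the size
    of the kernel.\<close>
  have "card {x. poly L x \<in> range (poly L)} = q ^ (l - s) * card {x. poly L x = 0}"
    using card_additive_vimage[of "poly L" "range (poly L)"] L_add card_range by simp
  moreover have "q ^ l = q ^ (l - s) * q ^ s"
    using p by (simp add: power_add[symmetric])
  ultimately have card_ker: "card {x. poly L x = 0} = q ^ s"
    using A(6) q1 by simp
  have card_L_vimage: "card {x. poly L x \<in> Y} = card Y * q ^ s" if "Y \<subseteq> W" for Y
  proof -
    \<comment> \<open>As s + 1 \<le> p, the conditions defining the image of L are among those
      defining \<open>W\<close>.\<close>
    have "W \<subseteq> range (poly L)" unfolding W L_range using p by auto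
    with that have "Y \<subseteq> range (poly L)" by blast
    thus ?thesis using card_additive_vimage[of "poly L" Y] L_add card_ker by simp
  qed
  have "card W = q ^ (d - s)"
    using p card_trace_eq[of "{2..p}" "\<lambda>_. 0"] by (simp add: W)
  hence card_A: "card A = q ^ d"
    using card_L_vimage[of W] sd by (simp add: A(24) power_add[symmetric])
  \<comment> \<open>The values L(x) at which the leading block vanishes. One condition is added to
    those of \<open>W\<close>, so the preimage shrinks by a factor q.\<close>
  define Y where "Y = {y. \<forall>i\<in>{1..p}. trace \<iota> (\<beta> i * y) = (if i = 1 then -1 else 0)}"
  have "card Y = q ^ (d - 1 - s)"
    unfolding Y_def using p by (subst card_trace_eq) auto
  moreover have "Y \<subseteq> W" by (auto simp: Y_def W)
  ultimately have card_LY: "card {x. poly L x \<in> Y} = q ^ (d - 1)"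
    using card_L_vimage[of Y] sd by (simp add: power_add[symmetric])

  have subspace: "V.subspace A"
  proof (rule V.subspaceI)
    show "0 \<in> A" by (simp add: A(24) W L_0 trace_0[OF hom_\<iota>])
    show "x + y \<in> A" if "x \<in> A" "y \<in> A" for x y
      using that by (simp add: A(24) W L_add distrib_left trace_add[OF hom_\<iota>])
    show "ext_scale \<iota> c x \<in> A" if "x \<in> A" for c x
      using that by (simp add: A(24) W L_scale ext_scale_def mult.left_commute[of _ "\<iota> c"] trace_scale[OF hom_\<iota>])
  qed
  have "q ^ V.dim A = q ^ d"
    using card_ext_subspace[OF hom_\<iota> subspace] A(4) card_A by simp
  hence dim: "V.dim A = d" using q1 by (simp add: power_inject_exp)

  have poly_g: "poly (g j) x = (if j \<le> m then \<gamma> j * (poly L x + 1) else \<gamma> j)" if "j \<in> {1..l}" for j x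
    using that A(25)[of j] A(26)[of j] by (auto simp: algebra_simps)

  have scheme: "linear_repair_scheme \<iota> A (q ^ d - r) 0 g"
    unfolding linear_repair_scheme_def deg card_A
  proof (intro conjI ballI)
    show "0 \<in> A" using subspace by (rule V.subspace_0)
    show "1 \<le> q ^ d - r" "q ^ d - r < q ^ d" using A(9,10) by auto
    fix j assume j: "j \<in> {1..l}"
    have "degree (g j) \<le> q ^ s"
    proof (cases "j \<le> m")
      case True
      thus ?thesis
        using A(25)[of j] j L_degree
        by (auto intro!: degree_add_le order.trans[OF degree_smult_le])
    qed (use A(26)[of j] j in auto)
    \<comment> \<open>The right-hand side is r, which exceeds q^s.\<close>
    thus "degree (g j) < q ^ d - (q ^ d - r)" using A(9,10) by simp
  next
    have g_0: "poly (g j) 0 = \<gamma> j" if "j \<in> {1..l}" for j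
      using poly_g[OF that] L_0 by simp
    have "(\<lambda>j. poly (g j) 0) ` {1..l} = \<gamma> ` {1..l}"
      using g_0 by (rule image_cong[OF refl])
    moreover have "inj_on (\<lambda>j. poly (g j) 0) {1..l} = inj_on \<gamma> {1..l}"
      using g_0 by (rule inj_on_cong)
    ultimately show "indep_family \<iota> {1..l} (\<lambda>j. poly (g j) 0)"
      using indep_family[unfolded \<iota>_eq] by (simp only: indep_family_def simp_thms)
  qed

  have matrix: "repair_matrix \<iota> \<beta> g x = block_matrix (poly L x + 1)" for x
    unfolding repair_matrix_def block_matrix_def deg \<iota>_eq
    by (rule cong_mat) (auto simp: poly_g mult.commute)
  have Y_iff: "(\<forall>i\<in>{1..m}. trace \<iota> (\<beta> i * (poly L x + 1)) = 0) \<longleftrightarrow> poly L x \<in> Y" if "x \<in> A" for x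
  proof -
    have y: "trace \<iota> (\<beta> i * poly L x) = 0" if "i \<in> {2..p}" for i
      using \<open>x \<in> A\<close> that by (simp add: A(24) W)
    \<comment> \<open>The trace of \<beta> i itself is a dual pairing, because \<gamma> 1 =
      1.\<close>
    have tr: "trace \<iota> (\<beta> i * (poly L x + 1)) = trace \<iota> (\<beta> i * poly L x) + (if i = 1 then 1 else 0)"
      if "i \<in> {1..l}" for i
      using dual'[OF that, of 1] \<gamma>_1 A(7) by (simp add: distrib_left trace_add[OF hom_\<iota>])
    have "(\<forall>i\<in>{1..m}. trace \<iota> (\<beta> i * (poly L x + 1)) = 0) \<longleftrightarrow> trace \<iota> (\<beta> 1 * poly L x) = -1"
    proof
      assume "\<forall>i\<in>{1..m}. trace \<iota> (\<beta> i * (poly L x + 1)) = 0"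
      hence "trace \<iota> (\<beta> 1 * (poly L x + 1)) = 0" using A(11) by auto
      thus "trace \<iota> (\<beta> 1 * poly L x) = -1"
        using tr[of 1] A(7) by (simp add: eq_neg_iff_add_eq_0)
    next
      assume 1: "trace \<iota> (\<beta> 1 * poly L x) = -1"
      \<comment> \<open>For indices from 2 to m both summands vanish, since m \<le> p and L(x) lies
        in \<open>W\<close>.\<close>
      show "\<forall>i\<in>{1..m}. trace \<iota> (\<beta> i * (poly L x + 1)) = 0"
      proof
        fix i assume i: "i \<in> {1..m}"
        show "trace \<iota> (\<beta> i * (poly L x + 1)) = 0"
          using tr[of i] 1 y[of i] i p by (cases "i = 1") auto
      qed
    qed
    also have "\<dots> \<longleftrightarrow> poly L x \<in> Y"
    proof
      assume 1: "trace \<iota> (\<beta> 1 * poly L x) = -1"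
      have "trace \<iota> (\<beta> i * poly L x) = (if i = 1 then -1 else 0)" if "i \<in> {1..p}" for i
        using 1 y[of i] that by (cases "i = 1") auto
      thus "poly L x \<in> Y" by (simp add: Y_def)
    next
      assume "poly L x \<in> Y"
      moreover have "1 \<in> {1..p}" using p by auto
      ultimately show "trace \<iota> (\<beta> 1 * poly L x) = -1" unfolding Y_def by auto
    qed
    finally show ?thesis .
  qed

  have nz_x: "int (nz (repair_matrix \<iota> \<beta> g x)) = int l - (if poly L x \<in> Y then int m else 0)"
    if "x \<in> A" for x
    using Y_iff[OF that] nz_block_matrix[of "poly L x + 1", unfolded \<iota>_eq] m_le
    by (simp add: matrix)
  \<comment> \<open>L(0) = 0 has trace pairing 0 with \<beta> 1 rather than -1, so removing node 0
    loses none of the q^(d-1) cheaper nodes.\<close>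
  have "poly L 0 \<notin> Y"
    using p by (auto simp: Y_def L_0 trace_0[OF hom_\<iota>] intro!: bexI[of _ 1])
  hence LY: "{x \<in> A - {0}. poly L x \<in> Y} = {x. poly L x \<in> Y}"
    using \<open>Y \<subseteq> W\<close> by (auto simp: A(24))
  have "int (io_cost \<iota> \<beta> A 0 g) = (\<Sum>x\<in>A - {0}. int l - (if poly L x \<in> Y then int m else 0))"
    unfolding io_cost_def of_nat_sum using nz_x by (intro sum.cong) auto
  also have "\<dots> = int (card (A - {0})) * int l - int (card {x \<in> A - {0}. poly L x \<in> Y}) * int m"
    by (simp add: sum_subtractf sum.If_cases Int_def)
  also have "int (card (A - {0})) = int n - 1"
    using V.subspace_0[OF subspace] card_A q1 by (simp add: A(14) of_nat_diff)
  also have "card {x \<in> A - {0}. poly L x \<in> Y} = q ^ (d - 1)"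
    unfolding LY by (rule card_LY)
  finally have cost: "int (io_cost \<iota> \<beta> A 0 g) = (int n - 1) * int l - int m * int q ^ (d - 1)"
    by (simp add: mult.commute)
  \<comment> \<open>The two costs agree node by node.\<close>
  have "repair_bandwidth \<iota> \<beta> A 0 g = io_cost \<iota> \<beta> A 0 g"
    by (simp add: repair_bandwidth_def io_cost_def deg matrix rank_block_matrix)
  moreover have "basis_family \<iota> {1..l} \<beta>"
    using trace_dual_families.basis_family[OF swap] \<iota>_eq by simp
  ultimately show ?thesis
    using subspace dim scheme cost by blast
qed

end
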